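(* Suppose $\gamma=0$ and $\rho>0$. Take $\tau_0>0$ and $\epsilon\in[0,1/2]$ with $\tau_0\|K\|^2<2\rho$, initialise $\lambda_0:=\mu_0:=1$, and update for $i\in\mathbb N$ $$\tau_i:=\tau_0,\qquad \omega_i:=\frac{\lambda_{i+1}^{-1}-1}{\lambda_i^{-1}-\epsilon}=\lambda_{i+1}\lambda_i^{-1},\qquad \sigma_{i+1}:=\frac{\lambda_i^2}{2\rho},\qquad \mu_{i+1}:=\lambda_{i+1}:=\frac{2}{1+\sqrt{1+4(\lambda_i^{-2}-\epsilon\lambda_i^{-1})}}.$$ Then the iterates $u^N=(x^N,y^N)$ generated by the IC-PDPS algorithm (defined in the context) and the associated auxiliary sequence $\{\eta^N\}$ satisfy both $\mathcal G_{0,\rho}(u^N;\widehat u)\to0$ and $\|\eta^N-\widehat y\|^2\to0$ at the rate $O(1/N^2)$ for any $\widehat u=(\widehat x,\widehat y)\in H^{-1}(0)$.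
   Context: $X,Y$ are (real) Hilbert spaces, $K\in\mathcal L(X;Y)$ is bounded linear, $G:X\to[-\infty,\infty]$ and $F^*:Y\to[-\infty,\infty]$ are convex, proper, lower semicontinuous, and (strongly) convex with factors $\gamma\ge0$ and $\rho\ge0$ respectively (i.e. $G-\frac\gamma2\|\cdot\|^2$ and $F^*-\frac\rho2\|\cdot\|^2$ are convex). $F^*$ is the Fenchel conjugate of a convex, proper, lower semicontinuous $F$. The set $H^{-1}(0)$ consists of the pairs $\widehat u=(\widehat x,\widehat y)\in X\times Y$ with $-K^*\widehat y\in\partial G(\widehat x)$ and $K\widehat x\in\partial F^*(\widehat y)$. $\mathbb N=\{0,1,2,\dots\}$. The proximal map is $\operatorname{prox}_{tG}(v):=\arg\min_x\, tG(x)+\frac12\|x-v\|^2$, i.e. $(I+t\partial G)^{-1}(v)$. IC-PDPS algorithm (inertial, corrected, primal-dual proximal splitting), for given parameters $(\tau_i,\sigma_{i+1},\lambda_i,\mu_{i+1},\omega_i)_{i\in\mathbb N}$: take arbitrary $\tilde x^0:=\bar x^0:=x^0\in X$ and $\tilde y^0:=\bar y^0:=y^0\in\operatorname{dom}\partial F^*$, and for $i=0,1,2,\dots$ set $\tilde\tau_i:=\tau_i/[1+\gamma\tau_i(\lambda_i^{-1}-1)]$, $\tilde\sigma_{i+1}:=\sigma_{i+1}/[1+\rho\sigma_{i+1}(\mu_{i+1}^{-1}-1)]$, $x^i_\gamma:=[\bar x^i+\gamma\tau_i(\lambda_i^{-1}-1)x^i]/[1+\gamma\tau_i(\lambda_i^{-1}-1)]$,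 $x^{i+1}:=\operatorname{prox}_{\tilde\tau_iG}(x^i_\gamma-\tilde\tau_iK^*\tilde y^i)$, $\bar x^{i+1}:=x^{i+1}+\lambda_{i+1}(\lambda_i^{-1}-1)(x^{i+1}-x^i)$, $\tilde x^{i+1}:=x^{i+1}+(\lambda_i^{-1}-1)(x^{i+1}-x^i)$, $y^i_\rho:=[\bar y^i+\rho\sigma_{i+1}(\mu_{i+1}^{-1}-1)y^i]/[1+\rho\sigma_{i+1}(\mu_{i+1}^{-1}-1)]$, $y^{i+1}:=\operatorname{prox}_{\tilde\sigma_{i+1}F^*}(y^i_\rho+\tilde\sigma_{i+1}K[\tilde x^{i+1}+\omega_i(\tilde x^{i+1}-\tilde x^i)])$, $\bar y^{i+1}:=y^{i+1}+\mu_{i+2}(\mu_{i+1}^{-1}-1)(y^{i+1}-y^i)$, $\tilde y^{i+1}:=y^{i+1}+(\mu_{i+1}^{-1}-1)(y^{i+1}-y^i)$. The auxiliary sequence is $z^i=(\zeta^i,\eta^i)$ with $\zeta^0:=x^0$, $\eta^0:=y^0$, $\zeta^{i+1}:=\lambda_i^{-1}x^{i+1}-(\lambda_i^{-1}-1)x^i$, $\eta^{i+1}:=\mu_{i+1}^{-1}y^{i+1}-(\mu_{i+1}^{-1}-1)y^i$. With $G_\gamma(x;\widehat x):=G(x)-\frac\gamma2\|x-\widehat x\|^2$ and $(F^* )_\rho(y;\widehat y):=F^*(y)-\frac\rho2\|y-\widehat y\|^2$, the strong convexity adjusted gap is $$\mathcal G_{\gamma,\rho}(x,y;\widehat x,\widehat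 y):=\bigl(G_\gamma(x;\widehat x)+\langle\widehat y,Kx\rangle-(F^* )_\rho(\widehat y;\widehat y)\bigr)-\bigl(G_\gamma(\widehat x;\widehat x)+\langle y,K\widehat x\rangle-(F^* )_\rho(y;\widehat y)\bigr).$$ *)

theory Defs
  imports "HOL-Analysis.Analysis" "HOL-Library.Landau_Symbols"
begin

definition proper_fun :: "('a \<Rightarrow> ereal) \<Rightarrow> bool" where
  "proper_fun f \<longleftrightarrow> (\<forall>x. f x \<noteq> -\<infinity>) \<and> (\<exists>x. f x \<noteq> \<infinity>)"

text \<open>The endpoints \<open>t = 0, 1\<close> hold trivially and are left out, so that no product \<open>0 * \<infinity>\<close>
  occurs.\<close>

definition convex_fun :: "('a::real_vector \<Rightarrow> ereal) \<Rightarrow> bool" where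
  "convex_fun f \<longleftrightarrow>
    (\<forall>x y t. 0 < t \<and> t < 1 \<longrightarrow>
      f ((1 - t) *\<^sub>R x + t *\<^sub>R y) \<le> ereal (1 - t) * f x + ereal t * f y)"

definition strongly_convex_fun :: "real \<Rightarrow> ('a::real_inner \<Rightarrow> ereal) \<Rightarrow> bool" where
  "strongly_convex_fun c f \<longleftrightarrow> convex_fun (\<lambda>x. f x - ereal (c / 2 * (norm x)\<^sup>2))"

definition lsc_fun :: "('a::topological_space \<Rightarrow> ereal) \<Rightarrow> bool" where
  "lsc_fun f \<longleftrightarrow> (\<forall>x. f x \<le> Liminf (at x) f)"

definition fenchel_conjugate :: "('a::real_inner \<Rightarrow> ereal) \<Rightarrow> 'a \<Rightarrow> ereal" where
  "fenchel_conjugate f y = (SUP x. ereal (y \<bullet> x) - f x)"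

text \<open>For a proper \<open>f\<close>, the set below is empty whenever \<open>f x = \<infinity>\<close>.\<close>

definition subdifferential :: "('a::real_inner \<Rightarrow> ereal) \<Rightarrow> 'a \<Rightarrow> 'a set" where
  "subdifferential f x = {v. \<forall>z. f x + ereal (v \<bullet> (z - x)) \<le> f z}"

text \<open>\<open>arg_min\<close> is a choice operator; in a Hilbert space the minimiser exists and is unique when
  \<open>t > 0\<close> and \<open>f\<close> is convex, proper and lower semicontinuous.\<close>

definition prox :: "real \<Rightarrow> ('a::real_inner \<Rightarrow> ereal) \<Rightarrow> 'a \<Rightarrow> 'a" where
  "prox t f v = arg_min (\<lambda>x. ereal t * f x + ereal ((norm (x - v))\<^sup>2 / 2)) (\<lambda>_. True)"

text \<open>From here on, \<open>Fs\<close> stands for the conjugate function \<open>F\<^sup>*\<close>.\<close>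

definition critical_points ::
  "('x::real_inner \<Rightarrow> 'y::real_inner) \<Rightarrow> ('x \<Rightarrow> ereal) \<Rightarrow> ('y \<Rightarrow> ereal) \<Rightarrow> ('x \<times> 'y) set" where
  "critical_points K G Fs =
    {(x, y). - adjoint K y \<in> subdifferential G x \<and> K x \<in> subdifferential Fs y}"

text \<open>\<open>strong_part c f x xh\<close> is \<open>f x - c/2 * \<parallel>x - xh\<parallel>\<^sup>2\<close>, written \<open>f\<^sub>c(x; xh)\<close> on paper.\<close>

definition strong_part :: "real \<Rightarrow> ('a::real_inner \<Rightarrow> ereal) \<Rightarrow> 'a \<Rightarrow> 'a \<Rightarrow> ereal" where
  "strong_part c f x xh = f x - ereal (c / 2 * (norm (x - xh))\<^sup>2)"

definition adjusted_gap ::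
  "('x::real_inner \<Rightarrow> 'y::real_inner) \<Rightarrow> ('x \<Rightarrow> ereal) \<Rightarrow> ('y \<Rightarrow> ereal) \<Rightarrow>
   real \<Rightarrow> real \<Rightarrow> 'x \<times> 'y \<Rightarrow> 'x \<times> 'y \<Rightarrow> ereal" where
  "adjusted_gap K G Fs \<gamma> \<rho> = (\<lambda>(x, y) (xh, yh).
     (strong_part \<gamma> G x xh + ereal (yh \<bullet> K x) - strong_part \<rho> Fs yh yh)
     - (strong_part \<gamma> G xh xh + ereal (y \<bullet> K xh) - strong_part \<rho> Fs y yh))"

text \<open>The suffixes \<open>b\<close> and \<open>t\<close> stand for bars and tildes over the iterates. The entries
  \<open>\<sigma> 0\<close> and \<open>\<mu> 0\<close> do not enter the algorithm.\<close>

definition ic_pdps ::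
  "('x::real_inner \<Rightarrow> 'y::real_inner) \<Rightarrow> ('x \<Rightarrow> ereal) \<Rightarrow> ('y \<Rightarrow> ereal) \<Rightarrow> real \<Rightarrow> real \<Rightarrow>
   (nat \<Rightarrow> real) \<Rightarrow> (nat \<Rightarrow> real) \<Rightarrow> (nat \<Rightarrow> real) \<Rightarrow> (nat \<Rightarrow> real) \<Rightarrow> (nat \<Rightarrow> real) \<Rightarrow>
   (nat \<Rightarrow> 'x) \<Rightarrow> (nat \<Rightarrow> 'x) \<Rightarrow> (nat \<Rightarrow> 'x) \<Rightarrow> (nat \<Rightarrow> 'y) \<Rightarrow> (nat \<Rightarrow> 'y) \<Rightarrow> (nat \<Rightarrow> 'y) \<Rightarrow> bool" where
  "ic_pdps K G Fs \<gamma> \<rho> \<tau> \<sigma> lam \<mu> \<omega> x xb xt y yb yt \<longleftrightarrow>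
    xt 0 = x 0 \<and> xb 0 = x 0 \<and> yt 0 = y 0 \<and> yb 0 = y 0 \<and>
    subdifferential Fs (y 0) \<noteq> {} \<and>
    (\<forall>i. let
        a = 1 + \<gamma> * \<tau> i * (inverse (lam i) - 1);
        \<tau>t = \<tau> i / a;
        x\<gamma> = (xb i + (\<gamma> * \<tau> i * (inverse (lam i) - 1)) *\<^sub>R x i) /\<^sub>R a;
        b = 1 + \<rho> * \<sigma> (i+1) * (inverse (\<mu> (i+1)) - 1);
        \<sigma>t = \<sigma> (i+1) / b;
        y\<rho> = (yb i + (\<rho> * \<sigma> (i+1) * (inverse (\<mu> (i+1)) - 1)) *\<^sub>R y i) /\<^sub>R b
      in
        x (i+1) = prox \<tau>t G (x\<gamma> - \<tau>t *\<^sub>R adjoint K (yt i)) \<and>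
        xb (i+1) = x (i+1) + (lam (i+1) * (inverse (lam i) - 1)) *\<^sub>R (x (i+1) - x i) \<and>
        xt (i+1) = x (i+1) + (inverse (lam i) - 1) *\<^sub>R (x (i+1) - x i) \<and>
        y (i+1) = prox \<sigma>t Fs
          (y\<rho> + \<sigma>t *\<^sub>R K (xt (i+1) + \<omega> i *\<^sub>R (xt (i+1) - xt i))) \<and>
        yb (i+1) = y (i+1) + (\<mu> (i+2) * (inverse (\<mu> (i+1)) - 1)) *\<^sub>R (y (i+1) - y i) \<and>
        yt (i+1) = y (i+1) + (inverse (\<mu> (i+1)) - 1) *\<^sub>R (y (i+1) - y i))"

text \<open>The dual component \<open>\<eta>\<close> of the auxiliary sequence \<open>z = (\<zeta>, \<eta>)\<close>; \<open>\<zeta>\<close> is not needed.\<close>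

primrec dual_aux :: "(nat \<Rightarrow> real) \<Rightarrow> (nat \<Rightarrow> 'y::real_vector) \<Rightarrow> nat \<Rightarrow> 'y" where
  "dual_aux \<mu> y 0 = y 0"
| "dual_aux \<mu> y (Suc i) =
    inverse (\<mu> (Suc i)) *\<^sub>R y (Suc i) - (inverse (\<mu> (Suc i)) - 1) *\<^sub>R y i"

end

theory Submission
  imports Defs
begin

text \<open>
  Write \<open>a\<^sub>i = 1 / \<lambda>\<^sub>i\<close>, so that \<open>a\<^sub>i\<^sub>+\<^sub>1\<^sup>2 - a\<^sub>i\<^sub>+\<^sub>1 = a\<^sub>i\<^sup>2 - \<epsilon> a\<^sub>i\<close> and \<open>a\<^sub>i\<close> grows at least like \<open>i / 4\<close>.
  The iterates with tilde coincide with the auxiliary sequence \<open>(\<zeta>, \<eta>)\<close>. The gap splits as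
  \<open>g(x) + h(y)\<close> with nonnegative Bregman-type distances \<open>g\<close>, \<open>h\<close> of \<open>G\<close> and
  \<open>F\<^sup>* - \<rho>/2 \<parallel>\<cdot> - yh\<parallel>\<^sup>2\<close>. Testing the subgradient inequality at \<open>x\<^sup>i\<^sup>+\<^sup>1\<close> with \<open>xh\<close> (weight \<open>1\<close>) and with
  the previous iterate \<open>x\<^sup>i\<close> (weight \<open>a\<^sub>i - 1\<close>), and likewise for \<open>y\<close>, shows that
  \<open>(a\<^sub>i\<^sup>2 - a\<^sub>i) g(x\<^sup>i) + a\<^sub>i\<^sup>2 h(y\<^sup>i) + \<parallel>\<zeta>\<^sup>i - xh\<parallel>\<^sup>2 / (2\<tau>) + \<rho> a\<^sub>i\<^sup>2 \<parallel>\<eta>\<^sup>i - yh\<parallel>\<^sup>2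
    - a\<^sub>i \<langle>K(\<zeta>\<^sup>i - xh), \<eta>\<^sup>i - yh\<rangle>\<close>
  does not increase. As \<open>\<tau>\<parallel>K\<parallel>\<^sup>2 < 2\<rho>\<close>, it dominates both
  \<open>(a\<^sub>i\<^sup>2 - a\<^sub>i) (g(x\<^sup>i) + h(y\<^sup>i))\<close> and a positive multiple of \<open>a\<^sub>i\<^sup>2 \<parallel>\<eta>\<^sup>i - yh\<parallel>\<^sup>2\<close>.
\<close>

subsection \<open>Strongly convex functions and the proximal map\<close>

lemma norm_affine_combination_sq:
  fixes x y :: "'a::real_inner"
  shows "(norm ((1 - t) *\<^sub>R x + t *\<^sub>R y))\<^sup>2
    = (1 - t) * (norm x)\<^sup>2 + t * (norm y)\<^sup>2 - t * (1 - t) * (norm (x - y))\<^sup>2"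
  unfolding power2_norm_eq_inner by (simp add: algebra_simps inner_commute)

text \<open>By the identity for affine combinations, the subtracted squared norms amount to the
  modulus term \<open>t * (1 - t)\<close>. Only finite endpoint values need testing: an infinite one
  makes the right-hand side of the convexity inequality infinite.\<close>

lemma strongly_convex_fun_iff:
  fixes f :: "'a::real_inner \<Rightarrow> ereal"
  assumes "\<And>x. f x \<noteq> -\<infinity>"
  shows "strongly_convex_fun c f \<longleftrightarrow>
    (\<forall>x y t r s. 0 < t \<and> t < 1 \<and> f x = ereal r \<and> f y = ereal s \<longrightarrow>
      f ((1 - t) *\<^sub>R x + t *\<^sub>R y)
        \<le> ereal ((1 - t) * r + t * s - c / 2 * (t * (1 - t)) * (norm (x - y))\<^sup>2))"
    (is "?L \<longleftrightarrow> ?R")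
proof
  assume L: ?L
  show ?R
  proof (intro allI impI, elim conjE)
    fix x y :: 'a and t r s :: real
    assume t: "0 < t" "t < 1" and r: "f x = ereal r" and s: "f y = ereal s"
    define z where "z = (1 - t) *\<^sub>R x + t *\<^sub>R y"
    have "f z - ereal (c / 2 * (norm z)\<^sup>2)
      \<le> ereal (1 - t) * (f x - ereal (c / 2 * (norm x)\<^sup>2))
        + ereal t * (f y - ereal (c / 2 * (norm y)\<^sup>2))"
      using L t unfolding strongly_convex_fun_def convex_fun_def z_def by blast
    moreover have "(norm z)\<^sup>2 = (1 - t) * (norm x)\<^sup>2 + t * (norm y)\<^sup>2
        - t * (1 - t) * (norm (x - y))\<^sup>2"
      unfolding z_def by (rule norm_affine_combination_sq)
    ultimately show "f ((1 - t) *\<^sub>R x + t *\<^sub>R y)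
        \<le> ereal ((1 - t) * r + t * s - c / 2 * (t * (1 - t)) * (norm (x - y))\<^sup>2)"
      unfolding z_def[symmetric] r s by (cases "f z") (auto simp: field_simps)
  qed
next
  assume R: ?R
  show ?L
    unfolding strongly_convex_fun_def convex_fun_def
  proof (intro allI impI, elim conjE)
    fix x y :: 'a and t :: real
    assume t: "0 < t" "t < 1"
    define z where "z = (1 - t) *\<^sub>R x + t *\<^sub>R y"
    have z: "(norm z)\<^sup>2 = (1 - t) * (norm x)\<^sup>2 + t * (norm y)\<^sup>2
        - t * (1 - t) * (norm (x - y))\<^sup>2"
      unfolding z_def by (rule norm_affine_combination_sq)
    consider r s where "f x = ereal r" "f y = ereal s" | "f x = \<infinity>" | "f y = \<infinity>"
      using assms by (metis ereal_cases)
    then have "f z - ereal (c / 2 * (norm z)\<^sup>2)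
      \<le> ereal (1 - t) * (f x - ereal (c / 2 * (norm x)\<^sup>2))
        + ereal t * (f y - ereal (c / 2 * (norm y)\<^sup>2))"
    proof cases
      case 1
      then have "f z \<le> ereal ((1 - t) * r + t * s - c / 2 * (t * (1 - t)) * (norm (x - y))\<^sup>2)"
        using R t unfolding z_def by blast
      then show ?thesis
        unfolding 1 z by (cases "f z") (auto simp: field_simps)
    next
      case 2
      then show ?thesis
        using t assms[of y] by (cases "f y") auto
    next
      case 3
      then show ?thesis
        using t assms[of x] by (cases "f x") auto
    qed
    then show "f ((1 - t) *\<^sub>R x + t *\<^sub>R y)
        - ereal (c / 2 * (norm ((1 - t) *\<^sub>R x + t *\<^sub>R y))\<^sup>2)
      \<le> ereal (1 - t) * (f x - ereal (c / 2 * (norm x)\<^sup>2))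
        + ereal t * (f y - ereal (c / 2 * (norm y)\<^sup>2))"
      unfolding z_def .
  qed
qed

text \<open>The punctured limit inferior can be replaced by full neighbourhoods because the centre
  itself satisfies the strict bound; the level bound then transfers to any sequence converging to
  the point, even one that hits it.\<close>

lemma lsc_fun_iff:
  assumes "\<And>x. f x \<noteq> -\<infinity>"
  shows "lsc_fun f \<longleftrightarrow> (\<forall>x r. ereal r < f x \<longrightarrow> (\<forall>\<^sub>F z in nhds x. ereal r < f z))"
proof
  assume L: "lsc_fun f"
  show "\<forall>x r. ereal r < f x \<longrightarrow> (\<forall>\<^sub>F z in nhds x. ereal r < f z)"
  proof (intro allI impI)
    fix x r assume r: "ereal r < f x"
    then have "\<forall>\<^sub>F z in nhds x. z \<noteq> x \<longrightarrow> ereal r < f z"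
      using L by (auto simp: lsc_fun_def le_Liminf_iff eventually_at_filter)
    then show "\<forall>\<^sub>F z in nhds x. ereal r < f z"
      by eventually_elim (use r in auto)
  qed
next
  assume R: "\<forall>x r. ereal r < f x \<longrightarrow> (\<forall>\<^sub>F z in nhds x. ereal r < f z)"
  show "lsc_fun f"
    unfolding lsc_fun_def le_Liminf_iff
  proof (intro allI impI)
    fix x y assume y: "y < f x"
    show "\<forall>\<^sub>F z in at x. y < f z"
    proof (cases y)
      case (real r)
      then show ?thesis
        using R y by (auto simp: eventually_at_filter elim!: eventually_mono)
    next
      case PInf
      then show ?thesis using y by simp
    next
      case MInf
      then show ?thesis using assms by simp
    qed
  qed
qed

lemma proper_finite:
  assumes "proper_fun f"
  obtains x r where "f x = ereal r"
  using assms unfolding proper_fun_def by (metis ereal_cases)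

text \<open>Coercivity needs no affine minorant: \<open>f\<close> is bounded below near a point by lower
  semicontinuity, and strong convexity along rays carries the bound outwards. Strong convexity at
  midpoints then makes every minimising sequence Cauchy.\<close>

lemma strongly_convex_attains_min:
  fixes f :: "'a::{real_inner,complete_space} \<Rightarrow> ereal"
  assumes c: "c > 0" and sc: "strongly_convex_fun c f" and pr: "proper_fun f" and lsc: "lsc_fun f"
  shows "\<exists>p. \<forall>z. f p \<le> f z"
proof -
  have nm: "f x \<noteq> -\<infinity>" for x
    using pr by (simp add: proper_fun_def)
  have conv: "f ((1 - t) *\<^sub>R x + t *\<^sub>R y)
        \<le> ereal ((1 - t) * r + t * s - c / 2 * (t * (1 - t)) * (norm (x - y))\<^sup>2)"
    if "0 < t" "t < 1" "f x = ereal r" "f y = ereal s" for x y t r s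
    using sc that unfolding strongly_convex_fun_iff[OF nm] by blast
  have low: "\<forall>\<^sub>F z in nhds x. ereal r < f z" if "ereal r < f x" for x r
    using lsc that unfolding lsc_fun_iff[OF nm] by blast
  obtain x0 r0 where x0: "f x0 = ereal r0"
    using proper_finite[OF pr] .
  have "\<forall>\<^sub>F z in nhds x0. ereal (r0 - 1) < f z"
    by (rule low) (simp add: x0)
  then obtain d where d: "d > 0" "\<And>z. dist z x0 < d \<Longrightarrow> ereal (r0 - 1) < f z"
    unfolding eventually_nhds_metric by blast
  define e where "e = d / 2"
  have e: "e > 0" "\<And>z. dist z x0 \<le> e \<Longrightarrow> ereal (r0 - 1) < f z"
    using d by (auto simp: e_def)
  \<comment> \<open>With \<open>q = 1 / e + c * e / 2\<close>, the amount
    \<open>q\<^sup>2 / (2 * c)\<close> is the largest drop of the quadratic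
    \<open>c / 2 * D\<^sup>2 - q * D\<close> found below for points at distance
    \<open>D > e\<close>; the extra \<open>1\<close> covers the ball around
    \<open>x0\<close>.\<close>
  define B where "B = r0 - 1 - (1 / e + c * e / 2)\<^sup>2 / (2 * c)"
  have B: "ereal B \<le> f z" for z
  proof (cases "dist z x0 \<le> e")
    case True
    have "B \<le> r0 - 1" using c by (simp add: B_def)
    then show ?thesis
      using e(2)[OF True] by (meson ereal_less_eq(3) less_imp_le order_trans)
  next
    case False
    define D where "D = dist z x0"
    have D: "D > e" "D > 0" using False e(1) by (auto simp: D_def)
    \<comment> \<open>This ratio puts the point \<open>p\<close> of the segment from
      \<open>x0\<close> to \<open>z\<close> at distance exactly \<open>e\<close> from
      \<open>x0\<close>, where the local lower bound applies.\<close>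
    define t where "t = e / D"
    have t: "0 < t" "t < 1" "t * D = e" using D e(1) by (auto simp: t_def)
    show ?thesis
    proof (cases "f z")
      case (real s)
      define p where "p = (1 - t) *\<^sub>R x0 + t *\<^sub>R z"
      have "p - x0 = t *\<^sub>R (z - x0)"
        by (simp add: p_def algebra_simps)
      then have "dist p x0 = t * D"
        using t by (simp add: dist_norm D_def)
      then have "ereal (r0 - 1) < f p"
        using e(2) t by simp
      also have "\<dots> \<le> ereal ((1 - t) * r0 + t * s - c / 2 * (t * (1 - t)) * (norm (x0 - z))\<^sup>2)"
        unfolding p_def by (rule conv) (use t x0 real in auto)
      also have "norm (x0 - z) = D"
        by (simp add: D_def dist_norm norm_minus_commute)
      finally have "r0 - 1 < (1 - t) * r0 + t * s - c / 2 * (t * (1 - t)) * D\<^sup>2"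
        by simp
      then have "t * (r0 - s) - 1 + c / 2 * (t * (1 - t)) * D\<^sup>2 < 0"
        by (simp add: algebra_simps)
      then have "D * (t * (r0 - s) - 1 + c / 2 * (t * (1 - t)) * D\<^sup>2) < 0"
        using D by (simp add: mult_less_0_iff)
      moreover have "D * (t * (r0 - s) - 1 + c / 2 * (t * (1 - t)) * D\<^sup>2)
          = (t * D) * (r0 - s) - D + c / 2 * ((t * D) * (D - t * D)) * D"
        by (simp add: field_simps power2_eq_square)
      ultimately have "e * (r0 - s) - D + c / 2 * (e * (D - e)) * D < 0"
        unfolding t by simp
      then have "(e * (r0 - s) - D + c / 2 * (e * (D - e)) * D) / e < 0"
        using e(1) by (simp add: divide_neg_pos)
      moreover have "(e * (r0 - s) - D + c / 2 * (e * (D - e)) * D) / e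
          = r0 - s - D / e + c / 2 * (D - e) * D"
        using e(1) by (simp add: field_simps)
      ultimately have "r0 - s - D / e + c / 2 * (D - e) * D < 0"
        by (simp only:)
      then have "s > r0 + c / 2 * D\<^sup>2 - (1 / e + c * e / 2) * D"
        by (simp add: algebra_simps power2_eq_square diff_divide_distrib)
      moreover have "c / 2 * D\<^sup>2 - q * D + q\<^sup>2 / (2 * c) = (c * D - q)\<^sup>2 / (2 * c)" for q
        using c by (simp add: field_simps power2_eq_square)
      then have "c / 2 * D\<^sup>2 - q * D + q\<^sup>2 / (2 * c) \<ge> 0" for q
        using c by simp
      from this[of "1 / e + c * e / 2"]
      have "c / 2 * D\<^sup>2 - (1 / e + c * e / 2) * D \<ge> B - r0"
        unfolding B_def by linarith
      ultimately show ?thesis by (simp add: real)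
    qed (use nm in auto)
  qed
  define m where "m = (INF z. f z)"
  have "ereal B \<le> m" unfolding m_def by (rule INF_greatest) (rule B)
  moreover have m_le: "m \<le> f z" for z unfolding m_def by (rule INF_lower) simp
  ultimately obtain M where M: "m = ereal M"
    using m_le[of x0] x0 by (cases m) auto
  have "\<exists>z. f z < ereal (M + 1 / real (Suc n))" for n
  proof -
    have "m < ereal (M + 1 / real (Suc n))" by (simp add: M)
    then show ?thesis unfolding m_def by (simp add: INF_less_iff)
  qed
  then obtain z where z: "\<And>n. f (z n) < ereal (M + 1 / real (Suc n))" by metis
  define v where "v n = real_of_ereal (f (z n))" for n
  have v: "f (z n) = ereal (v n)" "v n < M + 1 / real (Suc n)" for n
    using z[of n] nm[of "z n"] by (cases "f (z n)"; simp add: v_def)+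
  have gap: "c / 8 * (norm (z i - z j))\<^sup>2 \<le> 1 / real (Suc i) + 1 / real (Suc j)" for i j
  proof -
    have "ereal M \<le> f ((1 - 1/2) *\<^sub>R z i + (1/2) *\<^sub>R z j)"
      using m_le M by simp
    also have "\<dots> \<le> ereal ((1 - 1/2) * v i + 1/2 * v j
        - c / 2 * (1/2 * (1 - 1/2)) * (norm (z i - z j))\<^sup>2)"
      by (rule conv) (use v in auto)
    finally have "c / 8 * (norm (z i - z j))\<^sup>2 \<le> v i / 2 + v j / 2 - M" by simp
    moreover have "0 \<le> 1 / real (Suc i)" "0 \<le> 1 / real (Suc j)" by simp_all
    ultimately show ?thesis using v(2)[of i] v(2)[of j] by linarith
  qed
  have "Cauchy z"
  proof (rule metric_CauchyI)
    fix e :: real assume e: "e > 0"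
    obtain N where N: "1 / real (Suc N) < c * e\<^sup>2 / 16"
      using nat_approx_posE[of "c * e\<^sup>2 / 16"] c e by auto
    show "\<exists>N. \<forall>i\<ge>N. \<forall>j\<ge>N. dist (z i) (z j) < e"
    proof (intro exI allI impI)
      fix i j assume "i \<ge> N" "j \<ge> N"
      then have "1 / real (Suc i) \<le> 1 / real (Suc N)" "1 / real (Suc j) \<le> 1 / real (Suc N)"
        by (simp_all add: frac_le)
      then have "c / 8 * (norm (z i - z j))\<^sup>2 < c / 8 * e\<^sup>2"
        using gap[of i j] N by linarith
      then have "(norm (z i - z j))\<^sup>2 < e\<^sup>2" using c by simp
      then show "dist (z i) (z j) < e"
        using e by (simp add: dist_norm power2_less_imp_less)
    qed
  qed
  then obtain p where p: "z \<longlonglongrightarrow> p"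
    using Cauchy_convergent_iff convergent_def by blast
  have "f p \<le> ereal M"
  proof (rule ccontr)
    assume "\<not> f p \<le> ereal M"
    then have "ereal M < f p" by (simp add: not_le)
    then obtain r where r: "M < r" "ereal r < f p"
      using ereal_dense2[of "ereal M" "f p"] by auto
    have "\<forall>\<^sub>F n in sequentially. ereal r < f (z n)"
      using low[OF r(2)] p by (rule eventually_compose_filterlim)
    moreover have "(\<lambda>n. M + 1 / real (Suc n)) \<longlonglongrightarrow> M + 0"
      by (intro tendsto_intros LIMSEQ_Suc[OF lim_1_over_n])
    then have "\<forall>\<^sub>F n in sequentially. M + 1 / real (Suc n) < r"
      using r(1) by (intro order_tendstoD) simp_all
    ultimately have "\<forall>\<^sub>F n in sequentially. False"
    proof eventually_elim
      case (elim n)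
      then show ?case using v[of n] by simp
    qed
    then show False by simp
  qed
  then show ?thesis using m_le M by (metis order_trans)
qed

section \<open>Existence and optimality condition of the proximal point\<close>

lemma add_quadratic_strongly_convex:
  fixes f :: "'a::real_inner \<Rightarrow> ereal"
  assumes f: "convex_fun f" "proper_fun f" and t: "t > 0"
  shows "strongly_convex_fun 1 (\<lambda>x. ereal t * f x + ereal ((norm (x - v))\<^sup>2 / 2))"
proof -
  have nm: "f x \<noteq> -\<infinity>" for x
    using f by (simp add: proper_fun_def)
  have nm': "ereal t * f x + ereal ((norm (x - v))\<^sup>2 / 2) \<noteq> -\<infinity>" for x
    using nm[of x] t by (cases "f x") auto
  show ?thesis
    unfolding strongly_convex_fun_iff[OF nm']
  proof (intro allI impI, elim conjE)
    fix x y and u r s :: real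
    assume u: "0 < u" "u < 1"
      and r: "ereal t * f x + ereal ((norm (x - v))\<^sup>2 / 2) = ereal r"
      and s: "ereal t * f y + ereal ((norm (y - v))\<^sup>2 / 2) = ereal s"
    obtain r' where r': "f x = ereal r'" using r t nm[of x] by (cases "f x") auto
    obtain s' where s': "f y = ereal s'" using s t nm[of y] by (cases "f y") auto
    define z where "z = (1 - u) *\<^sub>R x + u *\<^sub>R y"
    have fz: "f z \<le> ereal ((1 - u) * r' + u * s')"
      using f(1) u r' s' unfolding convex_fun_def z_def by (metis plus_ereal.simps(1) times_ereal.simps(1))
    then obtain w where w: "f z = ereal w" "w \<le> (1 - u) * r' + u * s'"
      using nm[of z] by (cases "f z") auto
    have zv: "z - v = (1 - u) *\<^sub>R (x - v) + u *\<^sub>R (y - v)"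
      by (simp add: z_def algebra_simps)
    have zq: "(norm (z - v))\<^sup>2 = (1 - u) * (norm (x - v))\<^sup>2 + u * (norm (y - v))\<^sup>2
        - u * (1 - u) * (norm (x - y))\<^sup>2"
      unfolding zv norm_affine_combination_sq by simp
    have tw: "t * w \<le> t * ((1 - u) * r' + u * s')"
      using w t by simp
    have rs: "r = t * r' + (norm (x - v))\<^sup>2 / 2" "s = t * s' + (norm (y - v))\<^sup>2 / 2"
      using r s r' s' by auto
    have "t * w + (norm (z - v))\<^sup>2 / 2
        \<le> (1 - u) * r + u * s - 1 / 2 * (u * (1 - u)) * (norm (x - y))\<^sup>2"
      unfolding zq rs using tw by (simp add: field_simps)
    then show "ereal t * f ((1 - u) *\<^sub>R x + u *\<^sub>R y)
        + ereal ((norm ((1 - u) *\<^sub>R x + u *\<^sub>R y - v))\<^sup>2 / 2)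
      \<le> ereal ((1 - u) * r + u * s - 1 / 2 * (u * (1 - u)) * (norm (x - y))\<^sup>2)"
      unfolding z_def[symmetric] w by simp
  qed
qed

lemma add_quadratic_lsc:
  fixes f :: "'a::real_inner \<Rightarrow> ereal"
  assumes f: "lsc_fun f" "proper_fun f" and t: "t > 0"
  shows "lsc_fun (\<lambda>x. ereal t * f x + ereal ((norm (x - v))\<^sup>2 / 2))"
proof -
  have nm: "f x \<noteq> -\<infinity>" for x
    using f by (simp add: proper_fun_def)
  have nm': "ereal t * f x + ereal ((norm (x - v))\<^sup>2 / 2) \<noteq> -\<infinity>" for x
    using nm[of x] t by (cases "f x") auto
  show ?thesis
    unfolding lsc_fun_iff[OF nm']
  proof (intro allI impI)
    fix x r assume r: "ereal r < ereal t * f x + ereal ((norm (x - v))\<^sup>2 / 2)"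
    have "ereal ((r - (norm (x - v))\<^sup>2 / 2) / t) < f x"
      using r t nm[of x] by (cases "f x") (auto simp: field_simps)
    then obtain s where s: "(r - (norm (x - v))\<^sup>2 / 2) / t < s" "ereal s < f x"
      using ereal_dense2 by fastforce
    have "\<forall>\<^sub>F z in nhds x. ereal s < f z"
      using f(1) s(2) unfolding lsc_fun_iff[OF nm] by blast
    moreover have "((\<lambda>z. t * s + (norm (z - v))\<^sup>2 / 2) \<longlongrightarrow> t * s + (norm (x - v))\<^sup>2 / 2) (nhds x)"
      by (intro tendsto_intros filterlim_ident) simp_all
    then have "\<forall>\<^sub>F z in nhds x. r < t * s + (norm (z - v))\<^sup>2 / 2"
      using s(1) t by (intro order_tendstoD) (auto simp: field_simps)
    ultimately show "\<forall>\<^sub>F z in nhds x. ereal r < ereal t * f z + ereal ((norm (z - v))\<^sup>2 / 2)"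
    proof eventually_elim
      case (elim z)
      show ?case
      proof (cases "f z")
        case (real w)
        then have "t * s < t * w" using elim t by simp
        then show ?thesis using elim real by simp
      qed (use t nm[of z] in auto)
    qed
  qed
qed

lemma prox_minimises:
  fixes f :: "'a::{real_inner,complete_space} \<Rightarrow> ereal"
  assumes f: "convex_fun f" "proper_fun f" "lsc_fun f" and t: "t > 0"
  shows "ereal t * f (prox t f v) + ereal ((norm (prox t f v - v))\<^sup>2 / 2)
    \<le> ereal t * f z + ereal ((norm (z - v))\<^sup>2 / 2)"
proof -
  let ?\<phi> = "\<lambda>x. ereal t * f x + ereal ((norm (x - v))\<^sup>2 / 2)"
  have nm: "f x \<noteq> -\<infinity>" for x
    using f by (simp add: proper_fun_def)
  have nm': "?\<phi> x \<noteq> -\<infinity>" for x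
    using nm[of x] t by (cases "f x") auto
  obtain x0 r where "f x0 = ereal r" using proper_finite[OF f(2)] .
  then have "?\<phi> x0 \<noteq> \<infinity>" by simp
  with nm' have "proper_fun ?\<phi>" unfolding proper_fun_def by blast
  then obtain p where "\<forall>z. ?\<phi> p \<le> ?\<phi> z"
    using strongly_convex_attains_min[of 1 ?\<phi>] add_quadratic_strongly_convex[OF f(1,2) t]
      add_quadratic_lsc[OF f(3,2) t] by auto
  then have "is_arg_min ?\<phi> (\<lambda>_. True) p"
    by (auto simp: is_arg_min_def not_less)
  then have "is_arg_min ?\<phi> (\<lambda>_. True) (prox t f v)"
    unfolding prox_def arg_min_def by (rule someI)
  then show ?thesis by (auto simp: is_arg_min_def not_less)
qed

text \<open>Lets \<open>s\<close> tend to zero from the right; this finishes the first-order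
  arguments that compare values along a segment and divide by its parameter.\<close>

lemma le_of_small_perturbation:
  fixes A B C :: real
  assumes "\<And>s. 0 < s \<Longrightarrow> s < 1 \<Longrightarrow> A \<le> B + s * C"
  shows "A \<le> B"
proof -
  have "((\<lambda>s. B + s * C) \<longlongrightarrow> B + 0 * C) (at_right 0)"
    by (intro tendsto_intros)
  moreover have "\<forall>\<^sub>F s in at_right (0::real). A \<le> B + s * C"
    unfolding eventually_at_right_field using assms zero_less_one by blast
  ultimately show ?thesis
    using tendsto_lowerbound[of "\<lambda>s. B + s * C" "B + 0 * C" "at_right 0" A] by simp
qed

text \<open>Moving from the minimiser \<open>p\<close> a fraction \<open>s\<close> towards
  \<open>z\<close> changes the quadratic by a linear term plus one of order
  \<open>s\<^sup>2\<close>, while convexity bounds the change of \<open>f\<close> linearly. Dividing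
  by \<open>s\<close> leaves a remainder that vanishes with \<open>s\<close>.\<close>

lemma prox_subgradient:
  fixes f :: "'a::{real_inner,complete_space} \<Rightarrow> ereal"
  assumes f: "convex_fun f" "proper_fun f" "lsc_fun f" and t: "t > 0"
  shows "(1 / t) *\<^sub>R (v - prox t f v) \<in> subdifferential f (prox t f v)"
proof -
  define p where "p = prox t f v"
  have nm: "f x \<noteq> -\<infinity>" for x
    using f by (simp add: proper_fun_def)
  have min: "ereal t * f p + ereal ((norm (p - v))\<^sup>2 / 2)
    \<le> ereal t * f z + ereal ((norm (z - v))\<^sup>2 / 2)" for z
    unfolding p_def by (rule prox_minimises[OF f t])
  obtain x0 r0 where "f x0 = ereal r0" using proper_finite[OF f(2)] .
  then obtain P where P: "f p = ereal P"
    using min[of x0] t nm[of p] by (cases "f p") auto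
  have "f p + ereal ((1 / t) *\<^sub>R (v - p) \<bullet> (z - p)) \<le> f z" for z
  proof (cases "f z")
    case (real r)
    have "P + ((1 / t) *\<^sub>R (v - p)) \<bullet> (z - p) \<le> r + s * ((norm (z - p))\<^sup>2 / (2 * t))"
      if s: "0 < s" "s < 1" for s
    proof -
      define q where "q = (1 - s) *\<^sub>R p + s *\<^sub>R z"
      have "f q \<le> ereal ((1 - s) * P + s * r)"
        using f(1) s P real unfolding convex_fun_def q_def
        by (metis plus_ereal.simps(1) times_ereal.simps(1))
      then obtain w where w: "f q = ereal w" "w \<le> (1 - s) * P + s * r"
        using nm[of q] by (cases "f q") auto
      have "t * P + (norm (p - v))\<^sup>2 / 2 \<le> t * w + (norm (q - v))\<^sup>2 / 2"
        using min[of q] P w by simp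
      also have "t * w \<le> t * ((1 - s) * P + s * r)"
        using w t by simp
      also have "(norm (q - v))\<^sup>2
        = (norm (p - v))\<^sup>2 - 2 * s * ((v - p) \<bullet> (z - p)) + s * (s * (norm (z - p))\<^sup>2)"
        by (simp add: q_def power2_norm_eq_inner algebra_simps inner_commute)
      finally have "s * (t * P + (v - p) \<bullet> (z - p)) \<le> s * (t * r + s * ((norm (z - p))\<^sup>2 / 2))"
        by (simp add: field_simps)
      then have "t * P + (v - p) \<bullet> (z - p) \<le> t * r + s * ((norm (z - p))\<^sup>2 / 2)"
        using s by simp
      then have "(t * P + (v - p) \<bullet> (z - p)) / t \<le> (t * r + s * ((norm (z - p))\<^sup>2 / 2)) / t"
        using t by (simp add: divide_right_mono)
      then show ?thesis
        using t by (simp add: add_divide_distrib)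
    qed
    then have "P + ((1 / t) *\<^sub>R (v - p)) \<bullet> (z - p) \<le> r"
      by (rule le_of_small_perturbation)
    then show ?thesis by (simp add: P real)
  qed (use nm in auto)
  then show ?thesis
    unfolding subdifferential_def p_def by simp
qed

text \<open>The averaged centre and the shortened step \<open>s / (1 + d)\<close> are those of the
  algorithm. Clearing \<open>1 + d\<close> shows that they amount to two pulls: towards the inertial
  point \<open>w\<close> with weight \<open>1 / s\<close>, and towards the previous iterate
  \<open>z\<close> with weight \<open>d / s\<close>.\<close>

lemma prox_inertial_subgradient:
  fixes f :: "'a::{real_inner,complete_space} \<Rightarrow> ereal"
  assumes f: "convex_fun f" "proper_fun f" "lsc_fun f" and s: "s > 0" and d: "d \<ge> 0"
    and p: "p = prox (s / (1 + d)) f ((w + d *\<^sub>R z) /\<^sub>R (1 + d) + (s / (1 + d)) *\<^sub>R k)"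
  shows "(1 / s) *\<^sub>R (w - p) - (d / s) *\<^sub>R (p - z) + k \<in> subdifferential f p"
proof -
  have "(1 / (s / (1 + d))) *\<^sub>R (((w + d *\<^sub>R z) /\<^sub>R (1 + d) + (s / (1 + d)) *\<^sub>R k) - p)
      \<in> subdifferential f p"
    unfolding p by (rule prox_subgradient[OF f]) (use s d in simp)
  also have "(1 / (s / (1 + d))) *\<^sub>R (((w + d *\<^sub>R z) /\<^sub>R (1 + d) + (s / (1 + d)) *\<^sub>R k) - p)
      = (1 / s) *\<^sub>R (w + d *\<^sub>R z) + k - ((1 + d) / s) *\<^sub>R p"
    using s d by (simp add: scaleR_add_right scaleR_diff_right divide_simps)
  also have "\<dots> = (1 / s) *\<^sub>R (w - p) - (d / s) *\<^sub>R (p - z) + k"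
    by (simp add: algebra_simps add_divide_distrib)
  finally show ?thesis .
qed

text \<open>The proximal point of \<open>- f\<close> at the origin represents \<open>f\<close>.\<close>

lemma riesz_representation:
  fixes f :: "'a::{real_inner,complete_space} \<Rightarrow> real"
  assumes "bounded_linear f"
  obtains p where "\<And>x. f x = p \<bullet> x"
proof -
  interpret bounded_linear f by fact
  define \<phi> where "\<phi> = (\<lambda>x. ereal (- f x))"
  have "convex_fun \<phi>"
    by (simp add: convex_fun_def \<phi>_def add scaleR)
  moreover have "proper_fun \<phi>"
    by (simp add: proper_fun_def \<phi>_def)
  moreover have "lsc_fun \<phi>"
  proof -
    have "((\<lambda>z. - f z) \<longlongrightarrow> - f x) (nhds x)" for x
      by (intro tendsto_minus tendsto filterlim_ident)
    then have "\<forall>\<^sub>F z in nhds x. r < - f z" if "r < - f x" for x r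
      using that by (rule order_tendstoD(1))
    then show ?thesis
      by (subst lsc_fun_iff) (simp_all add: \<phi>_def)
  qed
  ultimately have "(1 / 1) *\<^sub>R (0 - prox 1 \<phi> 0) \<in> subdifferential \<phi> (prox 1 \<phi> 0)"
    by (rule prox_subgradient) simp
  then have le: "f z - f (prox 1 \<phi> 0) \<le> prox 1 \<phi> 0 \<bullet> (z - prox 1 \<phi> 0)" for z
    unfolding subdifferential_def by (simp add: \<phi>_def) (smt (verit))
  have "f x \<le> prox 1 \<phi> 0 \<bullet> x" for x
    using le[of "prox 1 \<phi> 0 + x"] by (simp add: add)
  from this[of x for x] this[of "- x" for x] have "f x = prox 1 \<phi> 0 \<bullet> x" for x
    by (simp add: neg antisym)
  then show ?thesis by (rule that)
qed

text \<open>\<open>adjoint\<close> is a choice operator, so its defining equation holds once some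
  adjoint exists; the Riesz representation supplies one pointwise in \<open>y\<close>.\<close>

lemma adjoint_inner:
  fixes K :: "'x::{real_inner,complete_space} \<Rightarrow> 'y::real_inner"
  assumes K: "bounded_linear K"
  shows "K x \<bullet> y = x \<bullet> adjoint K y"
proof -
  have "\<exists>p. \<forall>x. K x \<bullet> y = x \<bullet> p" for y
  proof -
    have "bounded_linear (\<lambda>x. K x \<bullet> y)"
      using bounded_linear_compose[OF bounded_linear_inner_left K] .
    then obtain p where "\<And>x. K x \<bullet> y = p \<bullet> x"
      using riesz_representation by blast
    then show ?thesis by (metis inner_commute)
  qed
  then have "\<exists>f'. \<forall>x y. K x \<bullet> y = x \<bullet> f' y" by metis
  then have "\<forall>x y. K x \<bullet> y = x \<bullet> adjoint K y"
    unfolding adjoint_def by (rule someI_ex)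
  then show ?thesis by blast
qed

section \<open>Subgradients of tilted functions and Bregman-type distances\<close>

lemma subdifferential_imp_finite:
  assumes "p \<in> subdifferential f x" "proper_fun f"
  shows "\<bar>f x\<bar> \<noteq> \<infinity>"
proof -
  obtain z r where "f z = ereal r" using proper_finite[OF assms(2)] .
  then have "f x + ereal (p \<bullet> (z - x)) \<le> ereal r"
    using assms(1) by (metis (mono_tags, lifting) mem_Collect_eq subdifferential_def)
  then show ?thesis
    using assms(2) by (cases "f x") (auto simp: proper_fun_def)
qed

text \<open>Strong convexity sharpens the subgradient inequality by
  \<open>c / 2 * (norm (x - z))\<^sup>2\<close>. This is exactly the second-order term in the
  expansion of the subtracted quadratic around \<open>x\<close>; its first-order term shifts the
  subgradient.\<close>

lemma strong_part_subgradient: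
  assumes sc: "strongly_convex_fun c f" and pr: "proper_fun f" and p: "p \<in> subdifferential f x"
  shows "p - c *\<^sub>R (x - xh) \<in> subdifferential (\<lambda>z. strong_part c f z xh) x"
proof -
  have nm: "f x \<noteq> -\<infinity>" for x
    using pr by (simp add: proper_fun_def)
  obtain P where P: "f x = ereal P"
    using subdifferential_imp_finite[OF p pr] by (cases "f x") auto
  have sub: "ereal P + ereal (p \<bullet> (z - x)) \<le> f z" for z
    using p unfolding subdifferential_def P[symmetric] by blast
  have "strong_part c f x xh + ereal ((p - c *\<^sub>R (x - xh)) \<bullet> (z - x)) \<le> strong_part c f z xh" for z
  proof (cases "f z")
    case (real r)
    have "P + p \<bullet> (z - x) \<le> (r - c / 2 * (norm (x - z))\<^sup>2) + t * (c / 2 * (norm (x - z))\<^sup>2)"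
      if t: "0 < t" "t < 1" for t
    proof -
      define q where "q = (1 - t) *\<^sub>R x + t *\<^sub>R z"
      have "q - x = t *\<^sub>R (z - x)" by (simp add: q_def algebra_simps)
      then have "ereal (P + t * (p \<bullet> (z - x))) \<le> f q"
        using sub[of q] by simp
      also have "f q \<le> ereal ((1 - t) * P + t * r - c / 2 * (t * (1 - t)) * (norm (x - z))\<^sup>2)"
        using sc t P real unfolding strongly_convex_fun_iff[OF nm] q_def by blast
      finally have "t * (P + p \<bullet> (z - x))
          \<le> t * ((r - c / 2 * (norm (x - z))\<^sup>2) + t * (c / 2 * (norm (x - z))\<^sup>2))"
        by (simp add: field_simps)
      then show ?thesis using t by simp
    qed
    then have "P + p \<bullet> (z - x) \<le> r - c / 2 * (norm (x - z))\<^sup>2"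
      by (rule le_of_small_perturbation)
    moreover define d where "d = (x - xh) \<bullet> (z - x)"
    have "(norm (z - xh))\<^sup>2 = (norm (x - xh))\<^sup>2 + 2 * d + (norm (x - z))\<^sup>2"
      unfolding power2_norm_eq_inner d_def by (simp add: algebra_simps inner_commute)
    moreover have "(p - c *\<^sub>R (x - xh)) \<bullet> (z - x) = p \<bullet> (z - x) - c * d"
      by (simp add: d_def inner_diff_left)
    ultimately have "P - c / 2 * (norm (x - xh))\<^sup>2 + (p - c *\<^sub>R (x - xh)) \<bullet> (z - x)
        \<le> r - c / 2 * (norm (z - xh))\<^sup>2"
      by (simp add: distrib_left)
    then show ?thesis by (simp add: strong_part_def P real)
  qed (use nm in \<open>auto simp: strong_part_def P\<close>)
  then show ?thesis unfolding subdifferential_def by blast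
qed

text \<open>An infinite \<open>f x\<close> counts as \<open>0\<close>. This can only happen at the starting point \<open>x 0\<close>, where the
  weight \<open>a - 1\<close> below vanishes.\<close>

definition bregman :: "('a::real_inner \<Rightarrow> ereal) \<Rightarrow> 'a \<Rightarrow> 'a \<Rightarrow> 'a \<Rightarrow> real" where
  "bregman f u xh x = real_of_ereal (f x) - real_of_ereal (f xh) - u \<bullet> (x - xh)"

lemma bregman_nonneg:
  assumes "u \<in> subdifferential f xh" "\<bar>f xh\<bar> \<noteq> \<infinity>" "\<bar>f x\<bar> \<noteq> \<infinity>"
  shows "bregman f u xh x \<ge> 0"
proof -
  have "f xh + ereal (u \<bullet> (x - xh)) \<le> f x"
    using assms(1) unfolding subdifferential_def by blast
  then show ?thesis
    using assms(2,3) by (auto simp: bregman_def)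
qed

text \<open>The weights \<open>1\<close> and \<open>a - 1\<close> add up to \<open>a\<close>, so all
  linear terms collect into one inner product with the extrapolated error. If \<open>a = 1\<close>,
  the value at \<open>x\<close> has weight zero and may be infinite.\<close>

lemma bregman_inertial_step:
  assumes p: "p \<in> subdifferential f x'"
    and fin: "\<bar>f xh\<bar> \<noteq> \<infinity>" "\<bar>f x'\<bar> \<noteq> \<infinity>"
    and a: "a \<ge> 1" "a = 1 \<or> \<bar>f x\<bar> \<noteq> \<infinity>"
  shows "a * bregman f u xh x' \<le> (a - 1) * bregman f u xh x
    + (p - u) \<bullet> (a *\<^sub>R x' - (a - 1) *\<^sub>R x - xh)"
proof -
  have sub: "real_of_ereal (f x') + p \<bullet> (z - x') \<le> real_of_ereal (f z)" if "\<bar>f z\<bar> \<noteq> \<infinity>" for z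
  proof -
    have "f x' + ereal (p \<bullet> (z - x')) \<le> f z"
      using p unfolding subdifferential_def by blast
    then show ?thesis using fin that by auto
  qed
  have 1: "real_of_ereal (f x') + p \<bullet> (xh - x') \<le> real_of_ereal (f xh)"
    using fin by (intro sub)
  have 2: "(a - 1) * (real_of_ereal (f x') + p \<bullet> (x - x')) \<le> (a - 1) * real_of_ereal (f x)"
    using a sub[of x] by (cases "a = 1") (auto intro: mult_left_mono)
  show ?thesis
    using 1 2 by (simp add: bregman_def algebra_simps)
qed

subsection \<open>The energy estimate\<close>

lemma peter_paul:
  fixes A B :: real
  assumes "t > 0"
  shows "A * B \<le> A\<^sup>2 / (2 * t) + t * B\<^sup>2 / 2"
proof -
  have "0 \<le> (A - t * B)\<^sup>2 / (2 * t)" using assms by simp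
  also have "\<dots> = A\<^sup>2 / (2 * t) + t * B\<^sup>2 / 2 - A * B"
    using assms by (simp add: field_simps power2_eq_square)
  finally show ?thesis by simp
qed

text \<open>Cauchy-Schwarz followed by the weighted Young inequality, with the weight
  \<open>t\<close> chosen so that the first square has the primal coefficient
  \<open>1 / (2 * t)\<close>.\<close>

lemma scaled_inner_le:
  fixes k v :: "'y::real_inner" and s :: "'x::real_normed_vector"
  assumes "norm k \<le> \<kappa> * norm s" "t > 0" "a \<ge> 0"
  shows "a * (k \<bullet> v) \<le> (norm s)\<^sup>2 / (2 * t) + t * \<kappa>\<^sup>2 / 2 * (a\<^sup>2 * (norm v)\<^sup>2)"
proof -
  have "k \<bullet> v \<le> norm k * norm v" by (rule norm_cauchy_schwarz)
  also have "\<dots> \<le> \<kappa> * norm s * norm v"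
    using assms(1) by (simp add: mult_right_mono)
  finally have "a * (k \<bullet> v) \<le> a * (\<kappa> * norm s * norm v)"
    using assms(3) by (rule mult_left_mono)
  also have "\<dots> = norm s * (a * \<kappa> * norm v)" by simp
  also have "\<dots> \<le> (norm s)\<^sup>2 / (2 * t) + t * (a * \<kappa> * norm v)\<^sup>2 / 2"
    using assms(2) by (rule peter_paul)
  finally show ?thesis by (simp add: power_mult_distrib algebra_simps)
qed

lemma inner_diff_telescope:
  fixes s s' :: "'a::real_inner"
  shows "(s - s') \<bullet> s' = ((norm s)\<^sup>2 - (norm s')\<^sup>2 - (norm (s' - s))\<^sup>2) / 2"
  unfolding power2_norm_eq_inner by (simp add: algebra_simps inner_commute)

text \<open>The primal inequality is multiplied by \<open>a\<close> and the dual one by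
  \<open>b\<close>. The coupling terms then telescope from \<open>a * (k \<bullet> v)\<close> to
  \<open>b * (k' \<bullet> v')\<close>, up to \<open>a * ((k' - k) \<bullet> (v' - v))\<close>,
  which the two negative squared increments absorb.\<close>

lemma energy_step:
  fixes s s' :: "'x::real_inner" and v v' k k' :: "'y::real_inner"
  assumes primal: "a * g' \<le> (a - 1) * g + (1 / (a * \<tau>)) * ((s - s') \<bullet> s') - v \<bullet> k'"
    and dual: "b * h' \<le> (b - 1) * h + (2 * \<rho> * a\<^sup>2 / b) * ((v - v') \<bullet> v') - \<rho> * (v' \<bullet> v')
      + (k' + (a / b) *\<^sub>R (k' - k)) \<bullet> v'"
    and ab: "b\<^sup>2 - b = a\<^sup>2 - \<epsilon> * a" "a \<ge> 1" "b \<ge> 1"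
    and pos: "0 \<le> g'" "0 \<le> h" "0 \<le> \<epsilon>" "\<tau> > 0" "\<rho> > 0" "\<tau> * \<kappa>\<^sup>2 \<le> 2 * \<rho>"
    and k: "norm (k' - k) \<le> \<kappa> * norm (s' - s)"
  shows "(b\<^sup>2 - b) * g' + b\<^sup>2 * h' + (norm s')\<^sup>2 / (2 * \<tau>) + \<rho> * b\<^sup>2 * (norm v')\<^sup>2 - b * (k' \<bullet> v')
    \<le> (a\<^sup>2 - a) * g + a\<^sup>2 * h + (norm s)\<^sup>2 / (2 * \<tau>) + \<rho> * a\<^sup>2 * (norm v)\<^sup>2 - a * (k \<bullet> v)"
proof -
  have P: "a\<^sup>2 * g' \<le> (a\<^sup>2 - a) * g
      + ((norm s)\<^sup>2 / (2 * \<tau>) - (norm s')\<^sup>2 / (2 * \<tau>) - (norm (s' - s))\<^sup>2 / (2 * \<tau>)) - a * (k' \<bullet> v)"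
  proof -
    have "a * (a * g') \<le> a * ((a - 1) * g + (1 / (a * \<tau>)) * ((s - s') \<bullet> s') - v \<bullet> k')"
      using primal ab by (intro mult_left_mono) auto
    also have "\<dots> = (a\<^sup>2 - a) * g + ((s - s') \<bullet> s') / \<tau> - a * (k' \<bullet> v)"
      using ab(2,3) by (simp add: right_diff_distrib distrib_left power2_eq_square inner_commute
        left_diff_distrib)
    finally show ?thesis
      unfolding inner_diff_telescope by (simp add: power2_eq_square diff_divide_distrib mult.assoc)
  qed
  have D: "b\<^sup>2 * h' \<le> (b\<^sup>2 - b) * h
      + \<rho> * a\<^sup>2 * ((norm v)\<^sup>2 - (norm v')\<^sup>2 - (norm (v' - v))\<^sup>2) - \<rho> * b * (norm v')\<^sup>2
      + b * (k' \<bullet> v') + a * ((k' - k) \<bullet> v')"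
  proof -
    have "b * (b * h') \<le> b * ((b - 1) * h + (2 * \<rho> * a\<^sup>2 / b) * ((v - v') \<bullet> v') - \<rho> * (v' \<bullet> v')
      + (k' + (a / b) *\<^sub>R (k' - k)) \<bullet> v')"
      using dual ab by (intro mult_left_mono) auto
    also have "\<dots> = (b\<^sup>2 - b) * h + 2 * \<rho> * a\<^sup>2 * ((v - v') \<bullet> v') - \<rho> * b * (v' \<bullet> v')
      + b * (k' \<bullet> v') + a * ((k' - k) \<bullet> v')"
      using ab(2,3) by (simp add: right_diff_distrib distrib_left power2_eq_square inner_add_left
        left_diff_distrib)
    finally show ?thesis
      unfolding inner_diff_telescope power2_norm_eq_inner[of v', symmetric]
      by (simp add: power2_eq_square mult.assoc)
  qed
  have "a * ((k' - k) \<bullet> (v' - v))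
      \<le> (norm (s' - s))\<^sup>2 / (2 * \<tau>) + \<tau> * \<kappa>\<^sup>2 / 2 * (a\<^sup>2 * (norm (v' - v))\<^sup>2)"
    using k pos ab by (intro scaled_inner_le) auto
  also have "\<tau> * \<kappa>\<^sup>2 / 2 * (a\<^sup>2 * (norm (v' - v))\<^sup>2) \<le> \<rho> * (a\<^sup>2 * (norm (v' - v))\<^sup>2)"
    using pos by (intro mult_right_mono) auto
  finally have C: "a * ((k' - k) \<bullet> (v' - v))
      \<le> (norm (s' - s))\<^sup>2 / (2 * \<tau>) + \<rho> * a\<^sup>2 * (norm (v' - v))\<^sup>2"
    by (simp add: mult.assoc)
  \<comment> \<open>Replacing \<open>b\<^sup>2 - b\<close> by
    \<open>a\<^sup>2 - \<epsilon> * a\<close> leaves these three surplus terms, all with the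
    favourable sign.\<close>
  have "0 \<le> (\<epsilon> * a) * g'" "0 \<le> (\<epsilon> * a) * h" "0 \<le> \<rho> * (\<epsilon> * a) * (norm v')\<^sup>2"
    using pos ab by auto
  moreover have b: "b\<^sup>2 = b + a\<^sup>2 - \<epsilon> * a"
    using ab(1) by simp
  have "\<rho> * b\<^sup>2 * (norm v')\<^sup>2
      = \<rho> * b * (norm v')\<^sup>2 + \<rho> * a\<^sup>2 * (norm v')\<^sup>2 - \<rho> * (\<epsilon> * a) * (norm v')\<^sup>2"
    unfolding b by (simp add: algebra_simps)
  moreover have "(b\<^sup>2 - b) * g' = a\<^sup>2 * g' - (\<epsilon> * a) * g'" "(b\<^sup>2 - b) * h = a\<^sup>2 * h - (\<epsilon> * a) * h"
    unfolding ab(1) by (simp_all add: algebra_simps)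
  moreover have "a * ((k' - k) \<bullet> (v' - v))
      = a * ((k' - k) \<bullet> v') - a * (k' \<bullet> v) + a * (k \<bullet> v)"
    by (simp add: algebra_simps)
  ultimately show ?thesis
    using P D C by (simp add: right_diff_distrib)
qed

text \<open>Young's inequality spends the whole primal square on the coupling term and leaves the
  dual square the factor \<open>\<rho> - \<tau> * \<kappa>\<^sup>2 / 2\<close>. Discarding
  \<open>a * h\<close> gives \<open>g\<close> and \<open>h\<close> a common weight.\<close>

lemma energy_lower_bound:
  fixes s :: "'x::real_inner" and v k :: "'y::real_inner"
  assumes "norm k \<le> \<kappa> * norm s" "\<tau> > 0" "a \<ge> 0" "0 \<le> h"
  shows "(a\<^sup>2 - a) * (g + h) + (\<rho> - \<tau> * \<kappa>\<^sup>2 / 2) * (a\<^sup>2 * (norm v)\<^sup>2)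
    \<le> (a\<^sup>2 - a) * g + a\<^sup>2 * h + (norm s)\<^sup>2 / (2 * \<tau>) + \<rho> * a\<^sup>2 * (norm v)\<^sup>2 - a * (k \<bullet> v)"
proof -
  have "a * (k \<bullet> v) \<le> (norm s)\<^sup>2 / (2 * \<tau>) + \<tau> * \<kappa>\<^sup>2 / 2 * (a\<^sup>2 * (norm v)\<^sup>2)"
    using assms by (intro scaled_inner_le) auto
  moreover have "0 \<le> a * h" using assms by simp
  ultimately show ?thesis by (simp add: left_diff_distrib distrib_left mult.assoc)
qed

section \<open>The momentum parameters and the passage from weights to rates\<close>

text \<open>For \<open>\<epsilon> \<le> 1 / 2\<close> the radicand dominates
  \<open>(2 * a i - 1 / 2)\<^sup>2\<close>, so each step adds at least \<open>1 / 4\<close>. The new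
  value is the larger root of the quadratic equation in the recurrence.\<close>

lemma momentum_sequence:
  fixes a :: "nat \<Rightarrow> real"
  assumes a0: "a 0 = 1" and a: "\<And>i. a (Suc i) = (1 + sqrt (1 + 4 * ((a i)\<^sup>2 - \<epsilon> * a i))) / 2"
    and \<epsilon>: "\<epsilon> \<le> 1 / 2"
  shows momentum_growth: "a i \<ge> 1 + real i / 4"
    and momentum_recurrence: "(a (Suc i))\<^sup>2 - a (Suc i) = (a i)\<^sup>2 - \<epsilon> * a i"
proof -
  have root: "1 + 4 * ((a i)\<^sup>2 - \<epsilon> * a i) \<ge> (2 * a i - 1 / 2)\<^sup>2" if "a i \<ge> 1" for i
  proof -
    have "\<epsilon> * a i \<le> 1 / 2 * a i"
      using \<epsilon> that by (intro mult_right_mono) auto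
    then show ?thesis by (simp add: power2_eq_square algebra_simps)
  qed
  have growth: "a i \<ge> 1 + real i / 4" for i
  proof (induction i)
    case 0
    then show ?case by (simp add: a0)
  next
    case (Suc i)
    then have "a i \<ge> 1" by (smt (verit) divide_nonneg_nonneg of_nat_0_le_iff)
    then have "2 * a i - 1 / 2 \<le> sqrt (1 + 4 * ((a i)\<^sup>2 - \<epsilon> * a i))"
      using root by (intro real_le_rsqrt)
    then show ?case using Suc by (simp add: a field_simps)
  qed
  then show "a i \<ge> 1 + real i / 4" .
  have "a i \<ge> 1" using growth[of i] by (smt (verit) divide_nonneg_nonneg of_nat_0_le_iff)
  then have "0 \<le> 1 + 4 * ((a i)\<^sup>2 - \<epsilon> * a i)"
    using root order_trans zero_le_power2 by blast
  then have "(sqrt (1 + 4 * ((a i)\<^sup>2 - \<epsilon> * a i)))\<^sup>2 = 1 + 4 * ((a i)\<^sup>2 - \<epsilon> * a i)"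
    by (rule real_sqrt_pow2)
  then show "(a (Suc i))\<^sup>2 - a (Suc i) = (a i)\<^sup>2 - \<epsilon> * a i"
    unfolding a by (simp add: power2_eq_square field_simps)
qed

lemma inverse_square_rate:
  fixes f :: "nat \<Rightarrow> real"
  assumes "\<And>N. N \<ge> 1 \<Longrightarrow> 0 \<le> f N \<and> f N * (real N)\<^sup>2 \<le> C"
  shows "f \<longlonglongrightarrow> 0" "f \<in> O(\<lambda>N. 1 / (real N)\<^sup>2)"
proof -
  have le: "\<forall>\<^sub>F N in sequentially. norm (f N) \<le> C * norm (1 / (real N)\<^sup>2)"
    using eventually_ge_at_top[of 1]
  proof eventually_elim
    case (elim N)
    then show ?case using assms[of N] by (simp add: field_simps)
  qed
  then show "f \<in> O(\<lambda>N. 1 / (real N)\<^sup>2)" by (rule bigoI)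
  have "(\<lambda>N. 1 / real N * (1 / real N)) \<longlonglongrightarrow> 0 * 0"
    by (intro tendsto_mult lim_1_over_n)
  then have "(\<lambda>N. C * norm (1 / (real N)\<^sup>2)) \<longlonglongrightarrow> C * 0"
    by (intro tendsto_mult_left) (simp add: power2_eq_square)
  then show "f \<longlonglongrightarrow> 0"
    using le by (simp add: Lim_null_comparison)
qed

theorem theorem4p7:
  fixes K :: "'x::{real_inner,complete_space} \<Rightarrow> 'y::{real_inner,complete_space}"
    and G :: "'x \<Rightarrow> ereal" and F Fs :: "'y \<Rightarrow> ereal"
    and \<gamma> \<rho> \<epsilon> :: real
    and \<tau> \<sigma> lam \<mu> \<omega> :: "nat \<Rightarrow> real"
    and x xb xt :: "nat \<Rightarrow> 'x" and y yb yt :: "nat \<Rightarrow> 'y"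
  assumes K: "bounded_linear K"
    and G: "convex_fun G" "proper_fun G" "lsc_fun G" "strongly_convex_fun \<gamma> G"
    and F: "convex_fun F" "proper_fun F" "lsc_fun F"
    and Fs_def: "Fs = fenchel_conjugate F"
    and Fs: "convex_fun Fs" "proper_fun Fs" "lsc_fun Fs" "strongly_convex_fun \<rho> Fs"
    and factors: "\<gamma> = 0" "\<rho> > 0"
    and init: "\<tau> 0 > 0" "0 \<le> \<epsilon>" "\<epsilon> \<le> 1 / 2" "\<tau> 0 * (onorm K)\<^sup>2 < 2 * \<rho>"
      "lam 0 = 1" "\<mu> 0 = 1"
    and tau: "\<And>i. \<tau> i = \<tau> 0"
    and omega: "\<And>i. \<omega> i = (inverse (lam (i+1)) - 1) / (inverse (lam i) - \<epsilon>)"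
    and sigma: "\<And>i. \<sigma> (i+1) = (lam i)\<^sup>2 / (2 * \<rho>)"
    and lam: "\<And>i. lam (i+1) =
        2 / (1 + sqrt (1 + 4 * ((inverse (lam i))\<^sup>2 - \<epsilon> * inverse (lam i))))"
    and mu: "\<And>i. \<mu> (i+1) = lam (i+1)"
    and iter: "ic_pdps K G Fs \<gamma> \<rho> \<tau> \<sigma> lam \<mu> \<omega> x xb xt y yb yt"
  shows "(\<forall>i. \<omega> i = lam (i+1) * inverse (lam i)) \<and>
    (\<forall>(xh, yh) \<in> critical_points K G Fs.
      ((\<lambda>N. adjusted_gap K G Fs 0 \<rho> (x N, y N) (xh, yh)) \<longlonglongrightarrow> 0) \<and>
      (\<lambda>N. real_of_ereal (adjusted_gap K G Fs 0 \<rho> (x N, y N) (xh, yh)))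
        \<in> O(\<lambda>N. 1 / (real N)\<^sup>2) \<and>
      ((\<lambda>N. (norm (dual_aux \<mu> y N - yh))\<^sup>2) \<longlonglongrightarrow> 0) \<and>
      (\<lambda>N. (norm (dual_aux \<mu> y N - yh))\<^sup>2) \<in> O(\<lambda>N. 1 / (real N)\<^sup>2))"
proof -

  \<comment> \<open>Change of variables and optimality conditions of the iterates\<close>
  interpret K: bounded_linear K by fact
  define a where "a i = inverse (lam i)" for i
  have lam_a: "lam i = 1 / a i" for i by (simp add: a_def divide_inverse)
  have a0: "a 0 = 1" using init by (simp add: a_def)
  have aS: "a (Suc i) = (1 + sqrt (1 + 4 * ((a i)\<^sup>2 - \<epsilon> * a i))) / 2" for i
    unfolding a_def using lam[of i] by simp
  note growth = momentum_growth[of a, OF a0 aS init(3)]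
  note rec = momentum_recurrence[of a, OF a0 aS init(3)]
  have a1: "a i \<ge> 1" for i
    using growth[of i] by (smt (verit) divide_nonneg_nonneg of_nat_0_le_iff)
  have a_pos: "a i > 0" for i using a1[of i] by linarith
  \<comment> \<open>Both forms of \<open>\<omega> i\<close> agree because the recurrence factors as
    \<open>(a (Suc i) - 1) * a (Suc i) = a i * (a i - \<epsilon>)\<close>.\<close>
  have om: "\<omega> i = a i / a (Suc i)" for i
  proof -
    have "a i - \<epsilon> \<noteq> 0" using a1[of i] init(3) by linarith
    moreover have "(a (Suc i) - 1) * a (Suc i) = a i * (a i - \<epsilon>)"
      using rec[of i] by (simp add: algebra_simps power2_eq_square)
    ultimately show ?thesis
      using a_pos[of "Suc i"] unfolding omega a_def[symmetric] by (simp add: frac_eq_eq)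
  qed
  have omega_id: "\<omega> i = lam (i+1) * inverse (lam i)" for i
    by (simp add: om lam_a)
  have start: "xt 0 = x 0" "xb 0 = x 0" "yt 0 = y 0" "yb 0 = y 0" "subdifferential Fs (y 0) \<noteq> {}"
    using iter unfolding ic_pdps_def by auto
  define d where "d i = \<rho> * \<sigma> (Suc i) * (a (Suc i) - 1)" for i
  \<comment> \<open>As \<gamma> = 0, the primal update is an inertial proximal step with
    \<open>d = 0\<close>; writing it with \<open>1 + 0\<close> lets one optimality lemma serve both
    updates.\<close>
  have step: "x (Suc i) = prox (\<tau> 0 / (1 + 0)) G
        ((xb i + 0 *\<^sub>R x i) /\<^sub>R (1 + 0) + (\<tau> 0 / (1 + 0)) *\<^sub>R (- adjoint K (yt i)))"
      "xb (Suc i) = x (Suc i) + (lam (Suc i) * (a i - 1)) *\<^sub>R (x (Suc i) - x i)"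
      "xt (Suc i) = x (Suc i) + (a i - 1) *\<^sub>R (x (Suc i) - x i)"
      "y (Suc i) = prox (\<sigma> (Suc i) / (1 + d i)) Fs
        ((yb i + d i *\<^sub>R y i) /\<^sub>R (1 + d i)
          + (\<sigma> (Suc i) / (1 + d i)) *\<^sub>R K (xt (Suc i) + \<omega> i *\<^sub>R (xt (Suc i) - xt i)))"
      "yb (Suc i) = y (Suc i) + (lam (Suc (Suc i)) * (a (Suc i) - 1)) *\<^sub>R (y (Suc i) - y i)"
      "yt (Suc i) = y (Suc i) + (a (Suc i) - 1) *\<^sub>R (y (Suc i) - y i)" for i
    using iter factors(1) mu[of i] mu[of "Suc i"] tau[of i]
    unfolding ic_pdps_def Let_def d_def a_def by (auto dest!: spec[of _ i])
  have xt: "xt (Suc i) = a i *\<^sub>R x (Suc i) - (a i - 1) *\<^sub>R x i" for i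
    unfolding step(3) by (simp add: algebra_simps)
  have yt: "yt (Suc i) = a (Suc i) *\<^sub>R y (Suc i) - (a (Suc i) - 1) *\<^sub>R y i" for i
    unfolding step(6) by (simp add: algebra_simps)
  have aux: "dual_aux \<mu> y i = yt i" for i
    using mu by (cases i) (simp_all add: start yt a_def)
  have xb: "xb i - x (Suc i) = (1 / a i) *\<^sub>R (xt i - xt (Suc i))" for i
  proof -
    have "xb i = x i + (1 / a i) *\<^sub>R (xt i - x i)"
      by (cases i) (simp_all add: start step(2,3) lam_a)
    then show ?thesis
      using a_pos[of i] unfolding xt by (simp add: algebra_simps diff_divide_distrib)
  qed
  \<comment> \<open>The dual parameters run one index ahead: \<open>yb i\<close> carries the weight
    \<open>1 / a (Suc i)\<close>, whereas \<open>xb i\<close> carries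
    \<open>1 / a i\<close>.\<close>
  have yb: "yb i - y (Suc i) = (1 / a (Suc i)) *\<^sub>R (yt i - yt (Suc i))" for i
  proof -
    have "yb i = y i + (1 / a (Suc i)) *\<^sub>R (yt i - y i)"
      by (cases i) (simp_all add: start step(5,6) lam_a)
    then show ?thesis
      using a_pos[of "Suc i"] unfolding yt by (simp add: algebra_simps diff_divide_distrib)
  qed
  have sig: "\<sigma> (Suc i) = 1 / (2 * \<rho> * (a i)\<^sup>2)" for i
    using sigma[of i] by (simp add: lam_a power_divide)
  have sig_pos: "\<sigma> (Suc i) > 0" for i
    using factors(2) a_pos[of i] by (simp add: sig)
  \<comment> \<open>The subgradients selected by the two proximal steps, in terms of the auxiliary
    iterates. The dual one keeps a correction in \<open>y (Suc i) - y i\<close> that comes from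
    strong convexity.\<close>
  define q where "q i = (1 / (a i * \<tau> 0)) *\<^sub>R (xt i - xt (Suc i)) - adjoint K (yt i)" for i
  define p where "p i = (2 * \<rho> * (a i)\<^sup>2 / a (Suc i)) *\<^sub>R (yt i - yt (Suc i))
      - (\<rho> * (a (Suc i) - 1)) *\<^sub>R (y (Suc i) - y i)
      + K (xt (Suc i) + (a i / a (Suc i)) *\<^sub>R (xt (Suc i) - xt i))" for i
  have q: "q i \<in> subdifferential G (x (Suc i))" for i
    using prox_inertial_subgradient[OF G(1-3) init(1) order_refl step(1)[of i]]
    by (simp add: q_def xb mult.commute)
  have p: "p i \<in> subdifferential Fs (y (Suc i))" for i
  proof -
    have "d i \<ge> 0"
      using sig_pos[of i] factors(2) a1[of "Suc i"] by (simp add: d_def)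
    from prox_inertial_subgradient[OF Fs(1-3) sig_pos this step(4)]
    have "(1 / \<sigma> (Suc i)) *\<^sub>R (yb i - y (Suc i)) - (d i / \<sigma> (Suc i)) *\<^sub>R (y (Suc i) - y i)
        + K (xt (Suc i) + \<omega> i *\<^sub>R (xt (Suc i) - xt i)) \<in> subdifferential Fs (y (Suc i))" .
    moreover have "d i / \<sigma> (Suc i) = \<rho> * (a (Suc i) - 1)"
      using sig_pos[of i] by (simp add: d_def)
    moreover have "(1 / \<sigma> (Suc i)) *\<^sub>R (yb i - y (Suc i))
        = (2 * \<rho> * (a i)\<^sup>2 / a (Suc i)) *\<^sub>R (yt i - yt (Suc i))"
      by (simp add: yb sig)
    ultimately show ?thesis by (simp add: p_def om)
  qed
  \<comment> \<open>\<open>G (x 0)\<close> may be infinite, so the claim starts at index one;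
    \<open>Fs (y 0)\<close> is finite because \<open>y 0\<close> is required to have a
    subgradient.\<close>
  have G_fin: "\<bar>G (x (Suc i))\<bar> \<noteq> \<infinity>" for i
    by (rule subdifferential_imp_finite[OF q G(2)])
  have Fs_fin: "\<bar>Fs (y i)\<bar> \<noteq> \<infinity>" for i
  proof (cases i)
    case 0
    obtain w where "w \<in> subdifferential Fs (y 0)" using start(5) by blast
    then show ?thesis using subdifferential_imp_finite[OF _ Fs(2)] 0 by simp
  next
    case (Suc j)
    then show ?thesis using subdifferential_imp_finite[OF p Fs(2)] by simp
  qed

  \<comment> \<open>The energy argument for a fixed critical point\<close>
  have "((\<lambda>N. adjusted_gap K G Fs 0 \<rho> (x N, y N) (xh, yh)) \<longlonglongrightarrow> 0) \<and>
      (\<lambda>N. real_of_ereal (adjusted_gap K G Fs 0 \<rho> (x N, y N) (xh, yh)))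
        \<in> O(\<lambda>N. 1 / (real N)\<^sup>2) \<and>
      ((\<lambda>N. (norm (dual_aux \<mu> y N - yh))\<^sup>2) \<longlonglongrightarrow> 0) \<and>
      (\<lambda>N. (norm (dual_aux \<mu> y N - yh))\<^sup>2) \<in> O(\<lambda>N. 1 / (real N)\<^sup>2)"
    if crit: "(xh, yh) \<in> critical_points K G Fs" for xh yh
  proof -
    have uG: "- adjoint K yh \<in> subdifferential G xh" and uF: "K xh \<in> subdifferential Fs yh"
      using crit by (auto simp: critical_points_def)
    have xh_fin: "\<bar>G xh\<bar> \<noteq> \<infinity>" and yh_fin: "\<bar>Fs yh\<bar> \<noteq> \<infinity>"
      by (rule subdifferential_imp_finite[OF uG G(2)], rule subdifferential_imp_finite[OF uF Fs(2)])
    \<comment> \<open>This is the tilted dual function of the adjusted gap. The subtracted quadratic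
      has zero gradient at its centre \<open>yh\<close>, so \<open>K xh\<close> remains a
      subgradient there.\<close>
    define Fr where "Fr z = strong_part \<rho> Fs z yh" for z
    have Fr_fin: "\<bar>Fr z\<bar> \<noteq> \<infinity>" if "\<bar>Fs z\<bar> \<noteq> \<infinity>" for z
      using that by (auto simp: Fr_def strong_part_def)
    have uFr: "K xh \<in> subdifferential Fr yh"
      using strong_part_subgradient[OF Fs(4,2) uF, where xh = yh] by (simp add: Fr_def[abs_def])
    have pr: "p i - \<rho> *\<^sub>R (y (Suc i) - yh) \<in> subdifferential Fr (y (Suc i))" for i
      using strong_part_subgradient[OF Fs(4,2) p, where xh = yh] by (simp add: Fr_def[abs_def])
    define g where "g i = bregman G (- adjoint K yh) xh (x i)" for i
    define h where "h i = bregman Fr (K xh) yh (y i)" for i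
    define s where "s i = xt i - xh" for i
    define v where "v i = yt i - yh" for i
    define k where "k i = K (s i)" for i
    have g_nonneg: "g (Suc i) \<ge> 0" for i
      unfolding g_def by (rule bregman_nonneg[OF uG xh_fin G_fin])
    have h_nonneg: "h i \<ge> 0" for i
      unfolding h_def by (rule bregman_nonneg[OF uFr Fr_fin[OF yh_fin] Fr_fin[OF Fs_fin]])
    have primal: "a i * g (Suc i) \<le> (a i - 1) * g i
      + (1 / (a i * \<tau> 0)) * ((s i - s (Suc i)) \<bullet> s (Suc i)) - v i \<bullet> k (Suc i)" for i
    proof -
      have "a i = 1 \<or> \<bar>G (x i)\<bar> \<noteq> \<infinity>"
        using a0 G_fin by (cases i) auto
      from bregman_inertial_step[OF q xh_fin G_fin a1 this, where u = "- adjoint K yh"]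
      have "a i * g (Suc i) \<le> (a i - 1) * g i + (q i - - adjoint K yh) \<bullet> s (Suc i)"
        by (simp add: g_def s_def xt)
      also have "(q i - - adjoint K yh) \<bullet> s (Suc i)
          = (1 / (a i * \<tau> 0)) * ((xt i - xt (Suc i)) \<bullet> s (Suc i))
            - s (Suc i) \<bullet> adjoint K (yt i) + s (Suc i) \<bullet> adjoint K yh"
        by (simp add: q_def inner_add_left inner_diff_left inner_commute[of "s (Suc i)"])
      also have "xt i - xt (Suc i) = s i - s (Suc i)" by (simp add: s_def)
      also have "s (Suc i) \<bullet> adjoint K (yt i) = yt i \<bullet> k (Suc i)"
        by (metis adjoint_inner[OF K] inner_commute k_def)
      also have "s (Suc i) \<bullet> adjoint K yh = yh \<bullet> k (Suc i)"
        by (metis adjoint_inner[OF K] inner_commute k_def)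
      finally show ?thesis
        by (simp add: v_def inner_diff_left)
    qed
    have dual: "a (Suc i) * h (Suc i) \<le> (a (Suc i) - 1) * h i
      + (2 * \<rho> * (a i)\<^sup>2 / a (Suc i)) * ((v i - v (Suc i)) \<bullet> v (Suc i)) - \<rho> * (v (Suc i) \<bullet> v (Suc i))
      + (k (Suc i) + (a i / a (Suc i)) *\<^sub>R (k (Suc i) - k i)) \<bullet> v (Suc i)" for i
    proof -
      have "a (Suc i) * h (Suc i) \<le> (a (Suc i) - 1) * h i
          + (p i - \<rho> *\<^sub>R (y (Suc i) - yh) - K xh) \<bullet> v (Suc i)"
        using bregman_inertial_step[OF pr[of i] Fr_fin[OF yh_fin] Fr_fin[OF Fs_fin]
            a1[of "Suc i"] disjI2[OF Fr_fin[OF Fs_fin[of i]]], where u = "K xh"]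
        by (simp add: h_def v_def yt)
      also have "p i - \<rho> *\<^sub>R (y (Suc i) - yh) - K xh
          = (2 * \<rho> * (a i)\<^sup>2 / a (Suc i)) *\<^sub>R (v i - v (Suc i)) - \<rho> *\<^sub>R v (Suc i)
            + (k (Suc i) + (a i / a (Suc i)) *\<^sub>R (k (Suc i) - k i))"
      proof -
        \<comment> \<open>The algorithm's strong convexity correction and the tilt of
          \<open>Fr\<close> combine into \<rho> times the auxiliary error; this yields the extra
          decrease \<open>\<rho> * (v' \<bullet> v')\<close> in the dual inequality.\<close>
        have \<rho>v: "\<rho> *\<^sub>R v (Suc i) = (\<rho> * (a (Suc i) - 1)) *\<^sub>R (y (Suc i) - y i) + \<rho> *\<^sub>R (y (Suc i) - yh)"
          by (simp add: v_def yt algebra_simps)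
        have Kxt: "K (xt (Suc i) + (a i / a (Suc i)) *\<^sub>R (xt (Suc i) - xt i)) - K xh
            = k (Suc i) + (a i / a (Suc i)) *\<^sub>R (k (Suc i) - k i)"
          by (simp add: k_def s_def K.add K.diff K.scaleR)
        have yv: "yt i - yt (Suc i) = v i - v (Suc i)" by (simp add: v_def)
        show ?thesis
          unfolding p_def yv \<rho>v Kxt[symmetric] by (simp add: algebra_simps)
      qed
      finally show ?thesis
        by (simp add: inner_add_left inner_diff_left)
    qed
    define E where "E i = ((a i)\<^sup>2 - a i) * g i + (a i)\<^sup>2 * h i + (norm (s i))\<^sup>2 / (2 * \<tau> 0)
      + \<rho> * (a i)\<^sup>2 * (norm (v i))\<^sup>2 - a i * (k i \<bullet> v i)" for i
    have K_bound: "norm (K z) \<le> onorm K * norm z" for z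
      by (rule onorm[OF K])
    have "E (Suc i) \<le> E i" for i
      unfolding E_def
    proof (rule energy_step[OF primal dual rec a1 a1 g_nonneg h_nonneg])
      show "norm (k (Suc i) - k i) \<le> onorm K * norm (s (Suc i) - s i)"
        using K_bound[of "s (Suc i) - s i"] by (simp add: k_def K.diff)
    qed (use init factors in auto)
    then have E_le: "E N \<le> E 0" for N
      using decseq_SucI[of E] by (simp add: decseq_def)
    define \<delta> where "\<delta> = \<rho> - \<tau> 0 * (onorm K)\<^sup>2 / 2"
    have \<delta>: "\<delta> > 0" using init by (simp add: \<delta>_def)
    have low: "((a N)\<^sup>2 - a N) * (g N + h N) + \<delta> * ((a N)\<^sup>2 * (norm (v N))\<^sup>2) \<le> E 0" for N
    proof -
      have "((a N)\<^sup>2 - a N) * (g N + h N) + \<delta> * ((a N)\<^sup>2 * (norm (v N))\<^sup>2) \<le> E N"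
        unfolding E_def \<delta>_def
        using K_bound init(1) less_imp_le[OF a_pos] h_nonneg
        by (intro energy_lower_bound) (simp_all add: k_def)
      then show ?thesis using E_le by (rule order_trans)
    qed
    \<comment> \<open>Linear growth bounds both \<open>a N\<close> and \<open>a N - 1\<close> below
      by \<open>N / 4\<close>, which is the source of the constant \<open>16\<close> in the
      rates.\<close>
    have sq: "(real N)\<^sup>2 / 16 \<le> (a N)\<^sup>2 - a N" for N
    proof -
      have "real N / 4 * (real N / 4) \<le> a N * (a N - 1)"
        using growth[of N] by (intro mult_mono) auto
      then show ?thesis by (simp add: power2_eq_square algebra_simps)
    qed
    have gh: "0 \<le> g N + h N" if "N \<ge> 1" for N
      using that g_nonneg[of "N - 1"] h_nonneg[of N] by simp
    have gap_rate: "0 \<le> g N + h N \<and> (g N + h N) * (real N)\<^sup>2 \<le> 16 * E 0" if "N \<ge> 1" for N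
    proof -
      have "(real N)\<^sup>2 / 16 * (g N + h N) \<le> ((a N)\<^sup>2 - a N) * (g N + h N)"
        using sq gh[OF that] by (rule mult_right_mono)
      moreover have "0 \<le> \<delta> * ((a N)\<^sup>2 * (norm (v N))\<^sup>2)" using \<delta> by simp
      ultimately show ?thesis using low[of N] gh[OF that] by (simp add: mult.commute)
    qed
    have v_rate: "0 \<le> (norm (v N))\<^sup>2 \<and> (norm (v N))\<^sup>2 * (real N)\<^sup>2 \<le> 16 * E 0 / \<delta>" if "N \<ge> 1" for N
    proof -
      have "(real N)\<^sup>2 / 16 \<le> (a N)\<^sup>2" using sq[of N] a_pos[of N] by linarith
      then have "\<delta> * ((real N)\<^sup>2 / 16 * (norm (v N))\<^sup>2) \<le> \<delta> * ((a N)\<^sup>2 * (norm (v N))\<^sup>2)"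
        using \<delta> by (intro mult_left_mono mult_right_mono) auto
      moreover have "0 \<le> (a N)\<^sup>2 - a N"
        by (rule order_trans[OF _ sq]) simp
      then have "0 \<le> ((a N)\<^sup>2 - a N) * (g N + h N)"
        using gh[OF that] by simp
      ultimately have "\<delta> * ((real N)\<^sup>2 / 16 * (norm (v N))\<^sup>2) \<le> E 0"
        using low[of N] by linarith
      then show ?thesis using \<delta> by (simp add: field_simps)
    qed
    \<comment> \<open>The terms \<open>yh \<bullet> K xh\<close> from the two distances cancel. At
      \<open>N = 0\<close> the gap can be infinite while \<open>g 0\<close> is a default real value,
      hence the restriction to \<open>N \<ge> 1\<close>.\<close>
    have gap: "adjusted_gap K G Fs 0 \<rho> (x N, y N) (xh, yh) = ereal (g N + h N)" if "N \<ge> 1" for N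
    proof -
      obtain i where i: "N = Suc i" using \<open>N \<ge> 1\<close> by (cases N) auto
      obtain r1 where r1: "G (x N) = ereal r1" using G_fin[of i] i by (cases "G (x N)") auto
      obtain r2 where r2: "G xh = ereal r2" using xh_fin by (cases "G xh") auto
      obtain r3 where r3: "Fs (y N) = ereal r3" using Fs_fin[of N] by (cases "Fs (y N)") auto
      obtain r4 where r4: "Fs yh = ereal r4" using yh_fin by (cases "Fs yh") auto
      have "adjoint K yh \<bullet> (x N - xh) = yh \<bullet> K (x N) - yh \<bullet> K xh"
        by (metis K.diff adjoint_inner[OF K] inner_commute inner_diff_right)
      then show ?thesis
        by (simp add: adjusted_gap_def strong_part_def g_def h_def bregman_def Fr_def r1 r2 r3 r4
            inner_diff_right inner_commute)
    qed
    have ev: "\<forall>\<^sub>F N in sequentially. ereal (g N + h N)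
        = adjusted_gap K G Fs 0 \<rho> (x N, y N) (xh, yh)"
      using eventually_ge_at_top[of 1] by eventually_elim (simp add: gap)
    have "(\<lambda>N. ereal (g N + h N)) \<longlonglongrightarrow> ereal 0"
      using inverse_square_rate(1)[OF gap_rate] by (intro tendsto_ereal)
    then have "(\<lambda>N. adjusted_gap K G Fs 0 \<rho> (x N, y N) (xh, yh)) \<longlonglongrightarrow> 0"
      unfolding zero_ereal_def using ev by (rule Lim_transform_eventually)
    moreover have "(\<lambda>N. real_of_ereal (adjusted_gap K G Fs 0 \<rho> (x N, y N) (xh, yh)))
        \<in> O(\<lambda>N. 1 / (real N)\<^sup>2)"
      by (rule inverse_square_rate(2)[where C = "16 * E 0"]) (use gap_rate in \<open>simp add: gap\<close>)
    moreover note inverse_square_rate[OF v_rate]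
    ultimately show ?thesis
      unfolding aux v_def by blast
  qed
  with omega_id show ?thesis by auto
qed

end
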